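(* Let $k\ge 1$, let $x\in S_{2k}$ be the $2k$-cycle $(0\ 1\ 2\ \dots\ 2k-1)$, and let $p$ be a positive divisor of $2k$. Let $\nu_p$ be the number of one-vertex maps with $k$ edges whose full automorphism group is $\langle x^p\rangle$, and for each divisor $p'$ of $2k$ let $\overline{\nu}_{p'}$ be the number of free involutions in $S_{2k}$ commuting with $x^{p'}$. Let $p_1,\dots,p_s$ be the distinct prime divisors of $p$. Then $$\nu_p=\overline{\nu}_p+\sum_{i=1}^s(-1)^i\sigma_i,$$ where $$\sigma_1=\sum_{1\le j\le s}\overline{\nu}_{p/p_j},\quad \sigma_2=\sum_{1\le j<l\le s}\overline{\nu}_{p/(p_jp_l)},\quad \sigma_3=\sum_{1\le j<l<m\le s}\overline{\nu}_{p/(p_jp_lp_m)},\ \dots,$$ i.e. $\sigma_i=\sum \overline{\nu}_{p/(p_{j_1}\cdots p_{j_i})}$, the sum being over all $1\le j_1<\dots<j_i\le s$.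
   Context: A free involution in $S_{2k}$ is a fixed-point-free involution (a product of $k$ disjoint transpositions). A map is a finite connected graph (loops and multiple edges allowed) embedded on a compact oriented surface with simply connected complementary faces; each edge carries two darts (directed edges). With $k$ edges and darts labelled $0,\dots,2k-1$, it is encoded by $x\in S_{2k}$, the product over the vertices of the cycles giving the counterclockwise order of the darts pointing to each vertex, and the free involution $y\in S_{2k}$ interchanging the two darts on each edge; its monodromy group is $\langle x,y\rangle$. For a one-vertex map, $x$ is a $2k$-cycle and, up to relabelling, is taken to be the standard cycle $(0\ 1\ \dots\ 2k-1)$; one-vertex maps with $k$ edges are then counted as the $(2k-1)!!$ free involutions $y\in S_{2k}$. The (full) automorphism group of the map is the centralizer of $\langle x,y\rangle$ in $S_{2k}$; it is a subgroup of $\langle x\rangle\simeq\mathbb{Z}_{2k}$. *)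

theory Defs
  imports
    "HOL-Algebra.Generated_Groups"
    "HOL-Combinatorics.Cycles"
    "HOL-Computational_Algebra.Primes"
begin

text \<open>
  \<open>S\<^sub>2\<^sub>k\<close> acting on the darts \<open>0, \<dots>, 2k - 1\<close>. The library's \<open>sym_group n\<close> acts on \<open>{1..n}\<close> instead.
  Elements are total functions that fix every number outside \<open>{0..<2*k}\<close>.
\<close>

definition dart_group :: "nat \<Rightarrow> (nat \<Rightarrow> nat) monoid" where
  "dart_group k = \<lparr>carrier = {f. f permutes {0..<2*k}}, monoid.mult = (\<circ>), one = id\<rparr>"

definition centralizer :: "('a, 'b) monoid_scheme \<Rightarrow> 'a set \<Rightarrow> 'a set" where
  "centralizer G H = {g \<in> carrier G. \<forall>h\<in>H. g \<otimes>\<^bsub>G\<^esub> h = h \<otimes>\<^bsub>G\<^esub> g}"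

definition free_involution :: "nat \<Rightarrow> (nat \<Rightarrow> nat) \<Rightarrow> bool" where
  "free_involution k y \<longleftrightarrow>
     y \<in> carrier (dart_group k) \<and> y \<circ> y = id \<and> (\<forall>i<2*k. y i \<noteq> i)"

definition std_cycle :: "nat \<Rightarrow> nat \<Rightarrow> nat" where
  "std_cycle k = cycle_of_list [0..<2*k]"

definition monodromy_group :: "nat \<Rightarrow> (nat \<Rightarrow> nat) \<Rightarrow> (nat \<Rightarrow> nat) \<Rightarrow> (nat \<Rightarrow> nat) set" where
  "monodromy_group k x y = generate (dart_group k) {x, y}"

text \<open>
  A pair \<open>(x, y)\<close> encodes a map with \<open>k\<close> edges: \<open>x\<close> rotates the darts around the vertices, \<open>y\<close> swaps
  the two darts of each edge, and transitivity says that the underlying graph is connected.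
\<close>

definition encodes_map :: "nat \<Rightarrow> (nat \<Rightarrow> nat) \<Rightarrow> (nat \<Rightarrow> nat) \<Rightarrow> bool" where
  "encodes_map k x y \<longleftrightarrow>
     x \<in> carrier (dart_group k) \<and> free_involution k y \<and>
     (\<forall>a<2*k. \<forall>b<2*k. \<exists>g\<in>monodromy_group k x y. g a = b)"

definition map_automorphisms :: "nat \<Rightarrow> (nat \<Rightarrow> nat) \<Rightarrow> (nat \<Rightarrow> nat) \<Rightarrow> (nat \<Rightarrow> nat) set" where
  "map_automorphisms k x y = centralizer (dart_group k) (monodromy_group k x y)"

text \<open>
  One-vertex maps are counted with labelled darts and \<open>x\<close> normalised to the standard cycle,
  hence by their involution \<open>y\<close>; they are not counted up to isomorphism.
\<close>

definition one_vertex_maps :: "nat \<Rightarrow> (nat \<Rightarrow> nat) set" where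
  "one_vertex_maps k = {y. encodes_map k (std_cycle k) y}"

definition nu :: "nat \<Rightarrow> nat \<Rightarrow> nat" where
  "nu k p = card {y \<in> one_vertex_maps k.
     map_automorphisms k (std_cycle k) y = generate (dart_group k) {std_cycle k ^^ p}}"

definition nu_bar :: "nat \<Rightarrow> nat \<Rightarrow> nat" where
  "nu_bar k p = card {y. free_involution k y \<and> y \<circ> (std_cycle k ^^ p) = (std_cycle k ^^ p) \<circ> y}"

text \<open>
  A choice of indices \<open>j\<^sub>1 < \<dots> < j\<^sub>i\<close> among the distinct prime divisors \<open>p\<^sub>1, \<dots>, p\<^sub>s\<close> of \<open>p\<close> is an
  \<open>i\<close>-element set \<open>J\<close> of prime divisors; the division is exact because \<open>\<Prod>J\<close> divides \<open>p\<close>.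
\<close>

definition sigma :: "nat \<Rightarrow> nat \<Rightarrow> nat \<Rightarrow> nat" where
  "sigma k p i = (\<Sum>J | J \<subseteq> prime_factors p \<and> card J = i. nu_bar k (p div \<Prod>J))"

end

theory Submission
  imports Defs "HOL-Algebra.Multiplicative_Group"
begin

text \<open>
  A permutation commuting with the cycle \<open>x\<close> is a power of \<open>x\<close>, so the automorphisms of the map
  \<open>y\<close> are the powers \<open>x\<^sup>m\<close> that commute with \<open>y\<close>. The exponents \<open>m\<close> of these powers are closed
  under gcd. Hence the automorphism group is exactly \<open>\<langle>x\<^sup>p\<rangle>\<close> iff \<open>y\<close> commutes with \<open>x\<^sup>p\<close> but with no
  \<open>x\<^bsup>p/q\<^esup>\<close> for a prime \<open>q\<close> dividing \<open>p\<close>, and commuting with \<open>x\<^bsup>p/q\<^esup>\<close> for all \<open>q\<close> in a nonempty set \<open>J\<close>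
  of such primes is the same as commuting with \<open>x\<^bsup>p/\<Prod>J\<^esup>\<close>. The formula is then
  inclusion-exclusion.
\<close>

section \<open>Inclusion-exclusion with terms grouped by the size of the index set\<close>

lemma card_Diff_UN_alternating:
  assumes "finite A" "finite Q" "\<And>q. q \<in> Q \<Longrightarrow> X q \<subseteq> A"
  shows "int (card (A - \<Union>(X ` Q))) =
    int (card A) + (\<Sum>i = 1..card Q. (-1) ^ i * (\<Sum>J | J \<subseteq> Q \<and> card J = i. int (card (\<Inter>(X ` J)))))"
proof -
  \<comment> \<open>The locale takes an additive function into a ring, hence integer-valued
    cardinality.\<close>
  interpret Incl_Excl finite "int \<circ> card"
    by unfold_locales (auto simp: card_Un_disjnt)
  let ?g = "\<lambda>J. (-1) ^ card J * int (card (\<Inter>(X ` J)))"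
  have fin: "finite {J. J \<subseteq> Q \<and> J \<noteq> {}}"
    using assms(2) by simp
  have cards: "card ` {J. J \<subseteq> Q \<and> J \<noteq> {}} \<subseteq> {1..card Q}"
  proof clarify
    fix J assume J: "J \<subseteq> Q" "J \<noteq> {}"
    then have "finite J" using assms(2) finite_subset by blast
    then have "card J \<noteq> 0" using J(2) by simp
    moreover have "card J \<le> card Q" using J(1) assms(2) card_mono by blast
    ultimately show "card J \<in> {1..card Q}" by simp
  qed
  have "int (card (\<Union>(X ` Q))) = (\<Sum>J | J \<subseteq> Q \<and> J \<noteq> {}. - ?g J)"
    using restricted_indexed[of Q X] assms finite_subset[OF assms(3) assms(1)] by simp
  also have "\<dots> = - (\<Sum>J | J \<subseteq> Q \<and> J \<noteq> {}. ?g J)"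
    by (rule sum_negf)
  \<comment> \<open>The sum is split along the fibres of \<open>card\<close>; by
    \<open>cards\<close>, the sizes from 1 to \<open>card Q\<close> cover all nonempty
    \<open>J\<close>.\<close>
  also have "(\<Sum>J | J \<subseteq> Q \<and> J \<noteq> {}. ?g J) =
      (\<Sum>i = 1..card Q. \<Sum>J | J \<in> {J. J \<subseteq> Q \<and> J \<noteq> {}} \<and> card J = i. ?g J)"
    by (rule sum.group[OF fin _ cards, symmetric]) simp
  also have "\<dots> = (\<Sum>i = 1..card Q. (-1) ^ i * (\<Sum>J | J \<subseteq> Q \<and> card J = i. int (card (\<Inter>(X ` J)))))"
  proof (rule sum.cong[OF refl])
    fix i assume "i \<in> {1..card Q}"
    \<comment> \<open>As \<open>i \<ge> 1\<close>, a set of size \<open>i\<close> is automatically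
      nonempty.\<close>
    then have "{J. J \<in> {J. J \<subseteq> Q \<and> J \<noteq> {}} \<and> card J = i} = {J. J \<subseteq> Q \<and> card J = i}"
      by auto
    then show "(\<Sum>J | J \<in> {J. J \<subseteq> Q \<and> J \<noteq> {}} \<and> card J = i. ?g J) =
        (-1) ^ i * (\<Sum>J | J \<subseteq> Q \<and> card J = i. int (card (\<Inter>(X ` J))))"
      by (simp add: sum_distrib_left)
  qed
  finally have "int (card (\<Union>(X ` Q))) =
    - (\<Sum>i = 1..card Q. (-1) ^ i * (\<Sum>J | J \<subseteq> Q \<and> card J = i. int (card (\<Inter>(X ` J)))))" .
  moreover have sub: "\<Union>(X ` Q) \<subseteq> A"
    using assms(3) by blast
  then have "int (card (A - \<Union>(X ` Q))) = int (card A) - int (card (\<Union>(X ` Q)))"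
    using assms(1) by (simp add: card_Diff_subset finite_subset of_nat_diff card_mono)
  ultimately show ?thesis by simp
qed

section \<open>Exponents whose powers commute with a given function\<close>

lemma commute_funpow_mult:
  fixes f y :: "'a \<Rightarrow> 'a"
  assumes "y \<circ> (f ^^ m) = (f ^^ m) \<circ> y"
  shows "y \<circ> (f ^^ (m * j)) = (f ^^ (m * j)) \<circ> y"
proof (induction j)
  case (Suc j)
  have "y \<circ> (f ^^ (m * Suc j)) = (y \<circ> (f ^^ m)) \<circ> (f ^^ (m * j))"
    by (simp add: funpow_add comp_assoc)
  also have "\<dots> = (f ^^ m) \<circ> (y \<circ> (f ^^ (m * j)))"
    by (simp add: assms comp_assoc)
  also have "\<dots> = (f ^^ (m * Suc j)) \<circ> y"
    unfolding Suc by (simp only: mult_Suc_right funpow_add comp_assoc)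
  finally show ?case .
qed simp

text \<open>Bezout over the naturals gives \<open>a * u = b * v + gcd a b\<close>. Both
  \<open>f ^^ (a * u)\<close> and \<open>f ^^ (b * v)\<close> commute with \<open>y\<close>, and the
  latter, being injective, cancels on the left.\<close>

lemma commute_funpow_gcd:
  fixes f y :: "'a \<Rightarrow> 'a"
  assumes "inj f" "a \<noteq> 0"
    and a: "y \<circ> (f ^^ a) = (f ^^ a) \<circ> y" and b: "y \<circ> (f ^^ b) = (f ^^ b) \<circ> y"
  shows "y \<circ> (f ^^ gcd a b) = (f ^^ gcd a b) \<circ> y"
proof -
  obtain u v where uv: "a * u = b * v + gcd a b"
    using bezout_nat[OF \<open>a \<noteq> 0\<close>] by blast
  let ?g = "f ^^ gcd a b" and ?h = "f ^^ (b * v)"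
  have h: "y \<circ> ?h = ?h \<circ> y"
    using b by (rule commute_funpow_mult)
  have "?h \<circ> (y \<circ> ?g) = y \<circ> (f ^^ (a * u))"
    unfolding uv funpow_add using h by (metis comp_assoc)
  also have "\<dots> = (f ^^ (a * u)) \<circ> y"
    using a by (rule commute_funpow_mult)
  also have "\<dots> = ?h \<circ> (?g \<circ> y)"
    unfolding uv funpow_add by (simp add: comp_assoc)
  finally have "?h \<circ> (y \<circ> ?g) = ?h \<circ> (?g \<circ> y)" .
  moreover have "inj ?h"
    using \<open>inj f\<close> by (rule inj_fn)
  ultimately show ?thesis
    by (metis fun.inj_map injD)
qed

text \<open>When a new prime \<open>q\<close> joins \<open>J\<close>, it is coprime to
  \<open>\<Prod>J\<close>, so \<open>p = q * \<Prod>J * c\<close> and \<open>c\<close> is the gcd of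
  \<open>p div q\<close> and \<open>p div \<Prod>J\<close>. Closure under gcd gives one direction,
  closure under multiples the other.\<close>

lemma commute_funpow_div_prod_iff:
  fixes f y :: "'a \<Rightarrow> 'a" and p :: nat
  assumes "inj f" "p > 0" "J \<subseteq> prime_factors p" "J \<noteq> {}"
  shows "(\<forall>q\<in>J. y \<circ> (f ^^ (p div q)) = (f ^^ (p div q)) \<circ> y) \<longleftrightarrow>
    y \<circ> (f ^^ (p div \<Prod>J)) = (f ^^ (p div \<Prod>J)) \<circ> y"
proof -
  let ?C = "\<lambda>m. y \<circ> (f ^^ m) = (f ^^ m) \<circ> y"
  have "finite J"
    using assms(3) finite_subset by blast
  \<comment> \<open>Divisibility is carried through the induction to keep the divisions
    exact.\<close>
  then have "\<Prod>J dvd p \<and> ((\<forall>q\<in>J. ?C (p div q)) \<longleftrightarrow> ?C (p div \<Prod>J))"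
    using assms(4,3)
  proof (induction J rule: finite_ne_induct)
    case (insert q J)
    have q: "prime q" "q dvd p"
      using insert.prems by (auto simp: in_prime_factors_iff)
    have cop: "coprime q (\<Prod>J)"
    proof (rule prod_coprime_right)
      fix r assume "r \<in> J"
      then have "prime r" "q \<noteq> r"
        using insert by (auto simp: in_prime_factors_iff)
      then show "coprime q r"
        using q(1) primes_coprime by blast
    qed
    obtain c where c: "p = q * \<Prod>J * c"
      using divides_mult[OF q(2) _ cop] insert by blast
    have pos: "q > 0" "\<Prod>J > 0" "c > 0"
      using c assms(2) by auto
    have divs: "p div q = c * \<Prod>J" "p div \<Prod>J = c * q" "p div (q * \<Prod>J) = c"
      using pos c by (simp_all add: ac_simps)
    have "gcd (c * \<Prod>J) (c * q) = c"
      using cop by (simp add: gcd_mult_left coprime_commute)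
    then have "?C c" if "?C (p div q)" "?C (p div \<Prod>J)"
      using commute_funpow_gcd[OF assms(1) _ that] pos divs by simp
    moreover have "?C (p div q)" "?C (p div \<Prod>J)" if "?C c"
      unfolding divs by (rule commute_funpow_mult[OF that])+
    moreover have "\<Prod>(insert q J) = q * \<Prod>J"
      using insert.hyps by simp
    moreover have "(\<forall>q\<in>J. ?C (p div q)) \<longleftrightarrow> ?C (p div \<Prod>J)"
      using insert by blast
    moreover have "q * \<Prod>J dvd p"
      unfolding c by simp
    ultimately show ?case
      unfolding divs(3)[symmetric] ball_simps(7) by metis
  qed (auto simp: in_prime_factors_iff)
  then show ?thesis by blast
qed

text \<open>Commuting with \<open>g\<close> is preserved by products and inverses, so automorphisms
  need only be tested against the two generators of the monodromy group.\<close>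

lemma (in group) centralizer_generate:
  assumes "S \<subseteq> carrier G"
  shows "centralizer G (generate G S) = centralizer G S"
proof
  show "centralizer G (generate G S) \<subseteq> centralizer G S"
    by (auto simp: centralizer_def intro: generate.incl)
  show "centralizer G S \<subseteq> centralizer G (generate G S)"
  proof
    fix g assume g: "g \<in> centralizer G S"
    then have gG: "g \<in> carrier G" by (simp add: centralizer_def)
    have "g \<otimes> h = h \<otimes> g" if "h \<in> generate G S" for h
      using that
    proof induction
      case (inv h)
      then have h: "h \<in> carrier G" "g \<otimes> h = h \<otimes> g"
        using assms g by (auto simp: centralizer_def)
      \<comment> \<open>Multiplying by \<open>inv h\<close> on both sides turns commutation with
        \<open>h\<close> into commutation with \<open>inv h\<close>.\<close>
      have "inv h \<otimes> (g \<otimes> h) \<otimes> inv h = inv h \<otimes> (h \<otimes> g) \<otimes> inv h"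
        using h by simp
      then show ?case
        using h(1) gG by (simp add: m_assoc inv_solve_left)
    next
      case (eng h1 h2)
      then have "h1 \<in> carrier G" "h2 \<in> carrier G"
        using assms generate_in_carrier by blast+
      then show ?case
        using eng.IH gG by (metis m_assoc)
    qed (use g in \<open>auto simp: centralizer_def\<close>)
    then show "g \<in> centralizer G (generate G S)"
      using gG by (simp add: centralizer_def)
  qed
qed

section \<open>The group of dart permutations\<close>

lemma carrier_dart_group [simp]: "f \<in> carrier (dart_group k) \<longleftrightarrow> f permutes {0..<2*k}"
  and mult_dart_group [simp]: "f \<otimes>\<^bsub>dart_group k\<^esub> g = f \<circ> g"
  and one_dart_group [simp]: "\<one>\<^bsub>dart_group k\<^esub> = id"
  by (simp_all add: dart_group_def)

lemma group_dart_group: "group (dart_group k)"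
proof (rule groupI)
  fix f assume "f \<in> carrier (dart_group k)"
  then show "\<exists>g\<in>carrier (dart_group k). g \<otimes>\<^bsub>dart_group k\<^esub> f = \<one>\<^bsub>dart_group k\<^esub>"
    using permutes_inv permutes_inv_o(2) by fastforce
qed (auto simp: permutes_compose permutes_id comp_assoc)

lemma finite_carrier_dart_group: "finite (carrier (dart_group k))"
  by (simp add: dart_group_def finite_permutations)

lemma pow_dart_group: "f [^]\<^bsub>dart_group k\<^esub> (m::nat) = f ^^ m"
  by (induction m) (simp_all add: nat_pow_def funpow_Suc_right del: funpow.simps(2))

section \<open>The standard cycle and its powers\<close>

lemma std_cycle_permutes: "std_cycle k permutes {0..<2*k}"
  using cycle_permutes[of "[0..<2*k]"] by (simp add: std_cycle_def)

lemma funpow_std_cycle_permutes: "(std_cycle k ^^ m) permutes {0..<2*k}"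
  using std_cycle_permutes by (rule permutes_funpow)

lemma inj_std_cycle: "inj (std_cycle k)"
  using std_cycle_permutes permutes_inj by blast

lemma funpow_std_cycle_apply:
  assumes "i < 2 * k"
  shows "(std_cycle k ^^ m) i = (i + m) mod (2 * k)"
proof -
  \<comment> \<open>Applying a cycle \<open>m\<close> times to its own list rotates the list by
    \<open>m\<close>.\<close>
  have "map (std_cycle k ^^ m) [0..<2*k] ! i = rotate m [0..<2*k] ! i"
    using cyclic_rotation[of "[0..<2*k]" m] by (simp add: std_cycle_def)
  then show ?thesis
    using assms by (simp add: nth_rotate add.commute)
qed

text \<open>In a finite group, natural exponents already exhaust a cyclic subgroup.\<close>

lemma generate_std_cycle_pow:
  "generate (dart_group k) {std_cycle k ^^ p} = {std_cycle k ^^ (p * j) | j. True}"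
  using group.generate_pow_on_finite_carrier[OF group_dart_group finite_carrier_dart_group,
      of "std_cycle k ^^ p" k]
  by (simp add: funpow_std_cycle_permutes pow_dart_group funpow_mult)

text \<open>Every dart \<open>i\<close> is the image of 0 under the \<open>i\<close>-th power of the
  cycle, so a commuting \<open>g\<close> is determined by \<open>g 0\<close>. Outside the darts both
  sides are the identity.\<close>

lemma commute_std_cycle_imp_funpow:
  assumes g: "g permutes {0..<2*k}" "g \<circ> std_cycle k = std_cycle k \<circ> g"
  shows "g = std_cycle k ^^ g 0"
proof
  fix i
  let ?x = "std_cycle k"
  show "g i = (?x ^^ g 0) i"
  proof (cases "i < 2 * k")
    case True
    then have lt: "0 < 2 * k" "g 0 < 2 * k"
      using permutes_in_image[OF g(1), of 0] by auto
    have "g \<circ> (?x ^^ i) = (?x ^^ i) \<circ> g"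
      using commute_funpow_mult[where y = g and f = ?x and m = 1 and j = i] g(2) by simp
    then have "g ((?x ^^ i) 0) = (?x ^^ i) (g 0)"
      by (metis comp_apply)
    then show ?thesis
      using True lt by (simp add: funpow_std_cycle_apply add.commute)
  next
    case False
    then show ?thesis
      using permutes_not_in[OF g(1)] permutes_not_in[OF funpow_std_cycle_permutes] by simp
  qed
qed

text \<open>Commuting with the cycle leaves only its powers; commuting with \<open>y\<close> then
  selects the exponents.\<close>

lemma map_automorphisms_std_cycle:
  assumes "y permutes {0..<2*k}"
  shows "map_automorphisms k (std_cycle k) y =
    {std_cycle k ^^ m | m. y \<circ> (std_cycle k ^^ m) = (std_cycle k ^^ m) \<circ> y}"
proof -
  let ?x = "std_cycle k"
  have "map_automorphisms k ?x y = centralizer (dart_group k) {?x, y}"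
    unfolding map_automorphisms_def monodromy_group_def
    using assms std_cycle_permutes
    by (intro group.centralizer_generate group_dart_group) auto
  also have "\<dots> = {?x ^^ m | m. y \<circ> (?x ^^ m) = (?x ^^ m) \<circ> y}" (is "?L = ?R")
  proof
    show "?L \<subseteq> ?R"
    proof
      fix g assume "g \<in> ?L"
      then have g: "g permutes {0..<2*k}" "g \<circ> ?x = ?x \<circ> g" "y \<circ> g = g \<circ> y"
        by (auto simp: centralizer_def)
      obtain m where "g = ?x ^^ m"
        using commute_std_cycle_imp_funpow[OF g(1,2)] by (rule that)
      then show "g \<in> ?R"
        using g(3) by blast
    qed
    show "?R \<subseteq> ?L"
      using funpow_std_cycle_permutes by (force simp: centralizer_def fun_eq_iff funpow_swap1)
  qed
  finally show ?thesis .
qed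

text \<open>The powers of the cycle alone act transitively on the darts, so connectedness holds for
  every \<open>y\<close>.\<close>

lemma one_vertex_maps_eq: "one_vertex_maps k = {y. free_involution k y}"
proof -
  have "\<exists>g\<in>monodromy_group k (std_cycle k) y. g a = b"
    if "free_involution k y" "a < 2 * k" "b < 2 * k" for y a b
  proof
    interpret group "dart_group k" by (rule group_dart_group)
    \<comment> \<open>Shifting by \<open>b - a\<close> modulo \<open>2 * k\<close>; adding
      \<open>2 * k\<close> keeps the exponent natural.\<close>
    let ?g = "std_cycle k ^^ (2 * k - a + b)"
    have "?g \<in> generate (dart_group k) {std_cycle k ^^ 1}"
      unfolding generate_std_cycle_pow by auto
    then show "?g \<in> monodromy_group k (std_cycle k) y"
      unfolding monodromy_group_def using mono_generate[of "{std_cycle k}" "{std_cycle k, y}"]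
      by auto
    show "?g a = b"
      using that by (simp add: funpow_std_cycle_apply)
  qed
  then show ?thesis
    by (auto simp: one_vertex_maps_def encodes_map_def std_cycle_permutes)
qed

text \<open>The numbers \<open>p div q\<close> are the maximal proper divisors of \<open>p\<close>,
  so excluding them excludes every commuting exponent that \<open>p\<close> does not divide.\<close>

lemma map_automorphisms_eq_generate_iff:
  assumes "k \<ge> 1" "p > 0" "p dvd 2 * k" "y permutes {0..<2*k}"
  shows "map_automorphisms k (std_cycle k) y = generate (dart_group k) {std_cycle k ^^ p} \<longleftrightarrow>
    y \<circ> (std_cycle k ^^ p) = (std_cycle k ^^ p) \<circ> y \<and>
    (\<forall>q\<in>prime_factors p. y \<circ> (std_cycle k ^^ (p div q)) \<noteq> (std_cycle k ^^ (p div q)) \<circ> y)"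
    (is "?Aut = ?gen \<longleftrightarrow> ?C p \<and> ?min")
proof
  let ?x = "std_cycle k"
  note Aut = map_automorphisms_std_cycle[OF assms(4)]
  note gen = generate_std_cycle_pow[of k p]
  \<comment> \<open>A power of the cycle fixes its exponent only modulo \<open>2 * k\<close>; since
    \<open>p\<close> divides \<open>2 * k\<close>, divisibility by \<open>p\<close> can still be
    read off.\<close>
  have dvd_if_mem: "p dvd m" if m: "?x ^^ m \<in> ?gen" for m
  proof -
    obtain j where "?x ^^ m = ?x ^^ (p * j)"
      using m unfolding gen by blast
    then have "(?x ^^ m) 0 = (?x ^^ (p * j)) 0"
      by simp
    then have "m mod (2 * k) = p * j mod (2 * k)"
      using assms(1) by (simp add: funpow_std_cycle_apply)
    then have "m mod p = p * j mod p"
      using assms(3) by (metis mod_mod_cancel)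
    then show ?thesis by (simp add: dvd_eq_mod_eq_0)
  qed
  show "?C p \<and> ?min" if eq: "?Aut = ?gen"
  proof
    have "?x ^^ p \<in> ?gen"
      by (intro generate.incl) simp
    then obtain m where "?x ^^ p = ?x ^^ m" "?C m"
      unfolding eq[symmetric] Aut by blast
    then show "?C p" by simp
    show ?min
    proof
      fix q assume "q \<in> prime_factors p"
      then have q: "prime q" "q dvd p" by (auto simp: in_prime_factors_iff)
      show "\<not> ?C (p div q)"
      proof
        assume "?C (p div q)"
        then have "p dvd p div q"
          using eq Aut dvd_if_mem by blast
        moreover have "0 < p div q" "p div q < p"
          using q assms(2) prime_gt_1_nat by (auto simp: div_greater_zero_iff dvd_imp_le)
        ultimately show False
          using nat_dvd_not_less by blast
      qed
    qed
  qed
  show "?Aut = ?gen" if C: "?C p \<and> ?min"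
  proof
    show "?gen \<subseteq> ?Aut"
      unfolding gen Aut using C commute_funpow_mult by blast
    have "p dvd m" if m: "?C m" for m
    proof (rule ccontr)
      assume "\<not> p dvd m"
      \<comment> \<open>\<open>d\<close> is a commuting exponent and a proper divisor of
        \<open>p\<close>, so it divides some \<open>p div q\<close>, which then commutes as
        well.\<close>
      define d where "d = gcd p m"
      have d: "d dvd p" "?C d"
        unfolding d_def using commute_funpow_gcd[OF inj_std_cycle _ _ m] C assms(2) by blast+
      have "d \<noteq> p"
        using \<open>\<not> p dvd m\<close> by (metis d_def gcd_dvd2)
      then obtain e where e: "p = d * e" "e \<noteq> 1"
        using d(1) by auto
      then obtain q where q: "prime q" "q dvd e"
        using prime_factor_nat by blast
      then obtain j where "e = q * j" by blast
      then have "q \<in> prime_factors p" "p div q = d * j"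
        using q e assms(2) by (auto simp: in_prime_factors_iff)
      then show False
        using C commute_funpow_mult[OF d(2), of j] by auto
    qed
    then show "?Aut \<subseteq> ?gen"
      unfolding gen Aut by blast
  qed
qed

section \<open>Counting maps by automorphism group\<close>

theorem theorem4p3:
  fixes k p :: nat
  assumes "k \<ge> 1" and "p > 0" and "p dvd 2 * k"
  shows "int (nu k p) =
    int (nu_bar k p) + (\<Sum>i = 1..card (prime_factors p). (-1) ^ i * int (sigma k p i))"
proof -
  define A where
    "A m = {y. free_involution k y \<and> y \<circ> (std_cycle k ^^ m) = (std_cycle k ^^ m) \<circ> y}" for m
  have nu_bar: "nu_bar k m = card (A m)" for m
    by (simp add: nu_bar_def A_def)
  have fin: "finite (A p)"
    by (rule finite_subset[OF _ finite_carrier_dart_group[of k]])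
      (auto simp: A_def free_involution_def)
  have sub: "A (p div q) \<subseteq> A p" if q: "q \<in> prime_factors p" for q
  proof -
    have "p = p div q * q"
      using q by (auto simp: in_prime_factors_iff)
    then show ?thesis
      unfolding A_def using commute_funpow_mult[where m = "p div q" and j = q] by force
  qed
  \<comment> \<open>\<open>J = {}\<close> is excluded because an empty intersection is the whole
    type, not \<open>A p\<close>.\<close>
  have Inter: "(\<Inter>q\<in>J. A (p div q)) = A (p div \<Prod>J)" if "J \<subseteq> prime_factors p" "J \<noteq> {}" for J
  proof (rule Set.set_eqI)
    fix y
    show "y \<in> (\<Inter>q\<in>J. A (p div q)) \<longleftrightarrow> y \<in> A (p div \<Prod>J)"
      using commute_funpow_div_prod_iff[OF inj_std_cycle[of k] assms(2) that, of y] that(2)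
      unfolding A_def by blast
  qed
  have "nu k p = card (A p - (\<Union>q\<in>prime_factors p. A (p div q)))"
    unfolding nu_def one_vertex_maps_eq
  proof (rule arg_cong[where f = card], intro Set.set_eqI)
    fix y
    show "y \<in> {y \<in> {y. free_involution k y}. map_automorphisms k (std_cycle k) y =
        generate (dart_group k) {std_cycle k ^^ p}} \<longleftrightarrow>
      y \<in> A p - (\<Union>q\<in>prime_factors p. A (p div q))"
      using map_automorphisms_eq_generate_iff[OF assms, of y]
      by (auto simp: A_def free_involution_def)
  qed
  then have "int (nu k p) = int (nu_bar k p) + (\<Sum>i = 1..card (prime_factors p). (-1) ^ i *
      (\<Sum>J | J \<subseteq> prime_factors p \<and> card J = i. int (card (\<Inter>q\<in>J. A (p div q)))))"
    unfolding nu_bar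
    using card_Diff_UN_alternating[of "A p" "prime_factors p" "\<lambda>q. A (p div q)"] fin sub by simp
  also have "(\<Sum>i = 1..card (prime_factors p). (-1) ^ i *
      (\<Sum>J | J \<subseteq> prime_factors p \<and> card J = i. int (card (\<Inter>q\<in>J. A (p div q))))) =
    (\<Sum>i = 1..card (prime_factors p). (-1) ^ i * int (sigma k p i))"
  proof (rule sum.cong[OF refl])
    fix i assume "i \<in> {1..card (prime_factors p)}"
    \<comment> \<open>The range starts at \<open>i = 1\<close>, so each \<open>J\<close> is nonempty
      and \<open>Inter\<close> applies.\<close>
    then have "(\<Sum>J | J \<subseteq> prime_factors p \<and> card J = i. int (card (\<Inter>q\<in>J. A (p div q)))) =
        (\<Sum>J | J \<subseteq> prime_factors p \<and> card J = i. int (nu_bar k (p div \<Prod>J)))"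
      unfolding nu_bar by (intro sum.cong refl arg_cong[where f = int] arg_cong[where f = card] Inter) auto
    then show "(-1) ^ i * (\<Sum>J | J \<subseteq> prime_factors p \<and> card J = i. int (card (\<Inter>q\<in>J. A (p div q)))) =
        (-1) ^ i * int (sigma k p i)"
      by (simp add: sigma_def)
  qed
  finally show ?thesis .
qed

end
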